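(* Let $m$ and $n$ be natural numbers with $m = n^2+2$ and $n \ge 5$, and let $\nu$ be an integer with $\nu < 2n+1$. If the diophantine equation $|x^2 - m y^2| = \nu$ has a solution $(x,y) \in \mathbb{Z}^2$, then $\nu = 2n-1$, or $\nu$ is a perfect square, or $2\nu$ is a perfect square. *)

theory Defs
  imports Complex_Main "HOL-Computational_Algebra.Nth_Powers"
begin

end

theory Submission
  imports Defs
begin

text \<open>
  Let \<open>m = n\<^sup>2 + 2\<close>.  The ring \<open>\<int>[\<surd>m]\<close> contains the unit \<open>(n\<^sup>2 + 1) + n\<surd>m\<close> of norm 1, half the square
  of the element \<open>n + \<surd>m\<close> of norm \<open>-2\<close>.  Dividing \<open>x + y\<surd>m\<close> by this unit preserves the form
  \<open>x\<^sup>2 - m y\<^sup>2\<close> and replaces \<open>y\<close> by \<open>y' = (n\<^sup>2 + 1) y - n x\<close>.  A solution with \<open>x, y \<ge> 0\<close> for which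
  \<open>\<bar>y'\<bar> < y\<close> therefore descends to a smaller one.  The descent stops in one of two ways: \<open>y' \<ge> y\<close>
  means \<open>x \<le> n y\<close>, and \<open>y' \<le> -y\<close> means \<open>m y \<le> n x\<close>.  Thus a terminal solution lies at or below the
  line \<open>x = n y\<close> (\<open>reduced_below\<close>), or far enough above it (\<open>reduced_above\<close>).  The form vanishes on the
  ray \<open>x = \<surd>m y\<close> between these two regions, so in each of them its size can be bounded below, and the
  only values up to \<open>2 n\<close> turn out to be \<open>2 y\<^sup>2\<close>, \<open>x\<^sup>2\<close> and \<open>2 n - 1\<close>.
\<close>

text \<open>
  Put \<open>j = n y - x\<close>.  Then \<open>m y\<^sup>2 - x\<^sup>2 = 2 y\<^sup>2 + j (2 n y - j)\<close>, where the last product increases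
  with \<open>j\<close> on \<open>0 \<le> j \<le> n y\<close>.  Already \<open>j = 1\<close> makes the form too large.
\<close>

lemma reduced_below:
  fixes n x y :: int
  assumes n: "n \<ge> 1" and x: "x \<ge> 0" and y: "y \<ge> 0" and le: "x \<le> n * y"
    and small: "\<bar>x\<^sup>2 - (n\<^sup>2 + 2) * y\<^sup>2\<bar> \<le> 2 * n"
  shows "\<bar>x\<^sup>2 - (n\<^sup>2 + 2) * y\<^sup>2\<bar> = 2 * y\<^sup>2"
proof (cases "x = n * y")
  case True
  then show ?thesis
    by (simp add: algebra_simps power_mult_distrib)
next
  case False
  define j where "j = n * y - x"
  have j: "j \<ge> 1" "j \<le> n * y" and xj: "x = n * y - j"
    using False le x by (auto simp: j_def)
  have "y \<noteq> 0"
    using False le x by auto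
  then have y1: "y \<ge> 1"
    using y by simp
  have "n * 1 \<le> n * y" "1 * 1 \<le> y * y"
    using n y1 by (intro mult_mono; simp)+
  moreover have "(j - 1) * (2 * (n * y) - j - 1) \<ge> 0"
    using j by simp
  moreover have "(n\<^sup>2 + 2) * y\<^sup>2 - x\<^sup>2
      = 2 * (y * y) + 2 * (n * y) - 1 + (j - 1) * (2 * (n * y) - j - 1)"
    unfolding xj by (simp add: power2_eq_square algebra_simps)
  ultimately have "(n\<^sup>2 + 2) * y\<^sup>2 - x\<^sup>2 > 2 * n"
    by linarith
  then show ?thesis
    using small by linarith
qed

text \<open>
  Put \<open>k = x - n y\<close>.  The hypothesis \<open>le\<close> reads \<open>2 y \<le> n k\<close>, which controls the negative term
  in \<open>x\<^sup>2 - m y\<^sup>2 = 2 n k y + k\<^sup>2 - 2 y\<^sup>2\<close> and leaves at least \<open>n k y + k\<^sup>2\<close>.  Since \<open>k\<close> and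
  \<open>y\<close> are positive, \<open>k y \<ge> 2\<close> would exceed the bound, so \<open>k = y = 1\<close>.
\<close>

lemma reduced_above:
  fixes n x y :: int
  assumes n: "n \<ge> 1" and y: "y > 0" and le: "(n\<^sup>2 + 2) * y \<le> n * x"
    and small: "\<bar>x\<^sup>2 - (n\<^sup>2 + 2) * y\<^sup>2\<bar> \<le> 2 * n"
  shows "\<bar>x\<^sup>2 - (n\<^sup>2 + 2) * y\<^sup>2\<bar> = 2 * n - 1"
proof -
  define k where "k = x - n * y"
  have xk: "x = n * y + k"
    by (simp add: k_def)
  have nk: "2 * y \<le> n * k"
    using le unfolding xk by (simp add: power2_eq_square algebra_simps)
  then have "0 < n * k"
    using y by linarith
  then have k: "k \<ge> 1"
    using n by (simp add: zero_less_mult_iff)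
  have form: "x\<^sup>2 - (n\<^sup>2 + 2) * y\<^sup>2 = 2 * (n * (k * y)) + k * k - 2 * (y * y)"
    unfolding xk by (simp add: power2_eq_square algebra_simps)
  have "2 * (y * y) \<le> n * (k * y)"
    using mult_right_mono[OF nk, of y] y by (simp add: mult.assoc)
  moreover have "1 * 1 \<le> k * k"
    using k by (intro mult_mono) auto
  ultimately have "n * (k * y) < 2 * n"
    using small unfolding form by linarith
  then have ky: "k * y < 2"
    using n by (simp add: mult.commute)
  have "k * 1 \<le> k * y" "1 * y \<le> k * y"
    using k y by (intro mult_mono; simp)+
  then have "k = 1" "y = 1"
    using ky k y by linarith+
  then show ?thesis
    using form n by simp
qed

text \<open>
  The descent on \<open>\<bar>y\<bar>\<close>.  Signs are dropped at each step, because the quotient by the unit may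
  have negative coordinates while the two terminal cases need nonnegative ones.
\<close>

lemma values_of_form:
  fixes n x y :: int
  assumes n: "n \<ge> 1"
    and small: "\<bar>x\<^sup>2 - (n\<^sup>2 + 2) * y\<^sup>2\<bar> \<le> 2 * n"
  shows "\<exists>z. \<bar>x\<^sup>2 - (n\<^sup>2 + 2) * y\<^sup>2\<bar> \<in> {2 * n - 1, z\<^sup>2, 2 * z\<^sup>2}"
  using small
proof (induction "nat \<bar>y\<bar>" arbitrary: x y rule: less_induct)
  case less
  define a b where "a = \<bar>x\<bar>" and "b = \<bar>y\<bar>"
  have ab: "a \<ge> 0" "b \<ge> 0"
    and form: "x\<^sup>2 - (n\<^sup>2 + 2) * y\<^sup>2 = a\<^sup>2 - (n\<^sup>2 + 2) * b\<^sup>2"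
    by (simp_all add: a_def b_def)
  have small': "\<bar>a\<^sup>2 - (n\<^sup>2 + 2) * b\<^sup>2\<bar> \<le> 2 * n"
    using less.prems form by simp
  define a' b' where "a' = (n\<^sup>2 + 1) * a - n * (n\<^sup>2 + 2) * b"
    and "b' = (n\<^sup>2 + 1) * b - n * a"
  have form': "a'\<^sup>2 - (n\<^sup>2 + 2) * b'\<^sup>2 = a\<^sup>2 - (n\<^sup>2 + 2) * b\<^sup>2"
    unfolding a'_def b'_def by algebra
  consider "\<bar>b'\<bar> < b" | "b \<le> b'" | "b' \<le> - b"
    by linarith
  then show ?case
  proof cases
    case 1
    then have "nat \<bar>b'\<bar> < nat \<bar>y\<bar>"
      by (simp add: b_def)
    from less.hyps[OF this, of a'] show ?thesis
      using small' unfolding form form' by blast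
  next
    case 2
    then have "n * a \<le> n * (n * b)"
      by (simp add: b'_def power2_eq_square algebra_simps)
    then have "a \<le> n * b"
      using n by simp
    then show ?thesis
      using reduced_below[OF n ab _ small'] form by auto
  next
    case 3
    then have le: "(n\<^sup>2 + 2) * b \<le> n * a"
      by (simp add: b'_def algebra_simps)
    show ?thesis
    proof (cases "b = 0")
      case True
      then show ?thesis
        using form by auto
    next
      case False
      then show ?thesis
        using reduced_above[OF n _ le small'] ab form by auto
    qed
  qed
qed

theorem proposition15:
  fixes m n :: nat and \<nu> :: int
  assumes "m = n^2 + 2" and "n \<ge> 5"
    and "\<nu> < 2 * int n + 1"
    and "\<exists>x y :: int. \<bar>x^2 - int m * y^2\<bar> = \<nu>"
  shows "\<nu> = 2 * int n - 1 \<or> is_square \<nu> \<or> is_square (2 * \<nu>)"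
proof -
  obtain x y :: int where xy: "\<bar>x\<^sup>2 - ((int n)\<^sup>2 + 2) * y\<^sup>2\<bar> = \<nu>"
    using assms(1,4) by (metis of_nat_add of_nat_numeral of_nat_power)
  obtain z where "\<nu> \<in> {2 * int n - 1, z\<^sup>2, 2 * z\<^sup>2}"
    using values_of_form[of "int n" x y] xy assms(2,3) by auto
  moreover have "is_square (2 * (2 * z\<^sup>2))"
    unfolding is_nth_power_def by (rule exI[of _ "2 * z"]) (simp add: power_mult_distrib)
  ultimately show ?thesis
    by auto
qed

end
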